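(* Let $\epsilon>0$, and suppose $m$ inexact iterations of right-preconditioned rational Krylov GMRES (RRK-GMRES, see context) have been performed for the shifted linear system $(\mathbf A-\mu\mathbf B)\mathbf y=\mathbf d$ with $\mathbf A,\mathbf B\in\mathbb C^{N\times N}$ and shifts $\sigma_1,\dots,\sigma_m$. Let $\mathbf r_m=\mathbf d-(\mathbf A-\mu\mathbf B)\mathbf y_m$ be the true residual and $\tilde{\mathbf r}_m$ the computed residual. If the inner residuals satisfy $$\|\mathbf p_k\|\le\frac{\mathrm{sval}_{\min}(\underline K_m-\mu\underline H_m)}{m}\,\frac{\epsilon}{\|\tilde{\mathbf r}_{k-1}\|},\qquad k=1,\dots,m,$$ then $\|\mathbf r_m\|\le\|\tilde{\mathbf r}_m\|+\epsilon$.
   Context: $\|\cdot\|$ is the Euclidean norm and $\mathrm{sval}_{\min}$ the smallest singular value. The quantities $\|\tilde{\mathbf r}_{k-1}\|$, $k=1,\dots,m$, appearing in denominators are nonzero. Inexact RRK-GMRES: let $\beta=\|\mathbf d\|\neq0$ and $\mathbf v_1=\mathbf d/\beta$. In iteration $k=1,\dots,m$ one picks $t_k\in\mathbb C^k$, sets $\mathbf v_{t,k}=\mathbf V_kt_k$ with $\mathbf V_k=[\mathbf v_1\cdots\mathbf v_k]$, and computes an approximate solution $\mathbf z_k$ of $(\mathbf A-\sigma_k\mathbf B)\mathbf z_k=\mathbf v_{t,k}$, with inner residual $$\mathbf p_k:=\mathbf v_{t,k}-(\mathbf A-\sigma_k\mathbf B)\mathbf z_k .$$ Then $\mathbf B\mathbf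 z_k$ is orthonormalized against $\mathbf V_k$ to give $\mathbf v_{k+1}$, so that $\mathbf V_{m+1}=[\mathbf v_1\cdots\mathbf v_{m+1}]$ has orthonormal columns and, with $\mathbf Z_m=[\mathbf z_1\cdots\mathbf z_m]$, $\mathbf B\mathbf Z_m=\mathbf V_{m+1}\underline H_m$ with $\underline H_m\in\mathbb C^{(m+1)\times m}$ upper Hessenberg. Let $\underline T_m\in\mathbb C^{(m+1)\times m}$ be the upper triangular matrix whose $k$-th column is $t_k$ padded with zeros, and $\underline K_m=\underline H_m\,\mathrm{diag}(\sigma_1,\dots,\sigma_m)+\underline T_m$. With $\mathbf P_m=[\mathbf p_1\cdots\mathbf p_m]$, this gives $(\mathbf A-\mu\mathbf B)\mathbf Z_m=\mathbf V_{m+1}(\underline K_m-\mu\underline H_m)-\mathbf P_m$. For $k\le m$, $\underline H_k,\underline K_k\in\mathbb C^{(k+1)\times k}$ denote the corresponding matrices after $k$ iterations (leading submatrices of $\underline H_m,\underline K_m$). For $1\le k\le m$ let $y^{\mathrm{red}}_k=\arg\min_{y\in\mathbb C^k}\|\beta e_1-(\underline K_k-\mu\underline H_k)y\|$. The computed residual is $\tilde{\mathbf r}_k:=\mathbf V_{k+1}\bigl(\beta e_1-(\underline K_k-\mu\underline H_k)y^{\mathrm{red}}_k\bigr)$ for $k\ge1$, and $\tilde{\mathbf r}_0:=\beta\mathbf v_1=\mathbf d$. The approximate solution is $\mathbf y_m=\mathbf Z_my^{\mathrm{red}}_m$. *)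

theory Defs
  imports
    "Jordan_Normal_Form.Spectral_Radius"
    "Jordan_Normal_Form.Schur_Decomposition"
    "HOL-Analysis.L2_Norm"
begin

definition vnorm :: "complex vec \<Rightarrow> real" where
  "vnorm x = L2_set (\<lambda>i. cmod (x $ i)) {..<dim_vec x}"

(* A p x q matrix has min p q singular values, the nonnegative square roots of the eigenvalues
   of the smaller of its two Gram matrices.  These eigenvalues are real and nonnegative, so
   taking real parts loses nothing. *)
definition singular_values :: "complex mat \<Rightarrow> real set" where
  "singular_values M =
     (\<lambda>l. sqrt (Re l)) ` spectrum (if dim_col M \<le> dim_row M then mat_adjoint M * M
                                   else M * mat_adjoint M)"

definition sval_min :: "complex mat \<Rightarrow> real" where
  "sval_min M = Min (singular_values M)"

(* Sequences of vectors and shifts are numbered from 1, entries of vectors and matrices from 0. *)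

definition cols_upto :: "nat \<Rightarrow> nat \<Rightarrow> (nat \<Rightarrow> complex vec) \<Rightarrow> complex mat" where
  "cols_upto N k x = mat_of_cols N (map x [1..<Suc k])"

definition leading :: "nat \<Rightarrow> nat \<Rightarrow> complex mat \<Rightarrow> complex mat" where
  "leading p q M = mat p q (\<lambda>(i, j). M $$ (i, j))"

definition upper_hessenberg :: "complex mat \<Rightarrow> bool" where
  "upper_hessenberg M \<longleftrightarrow>
     (\<forall>i < dim_row M. \<forall>j < dim_col M. j + 1 < i \<longrightarrow> M $$ (i, j) = 0)"

(* The vectors z k are approximate solutions of (A - sigma k B) z k = V k (t k) of unspecified
   accuracy, hence arbitrary; their quality is measured by inner_residual below.  The
   orthonormalization of B (z k) against V k is recorded by its outcome, the last three
   assumptions, so that every variant (classical or modified Gram-Schmidt, Householder, ...)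
   is covered. *)
locale inexact_rrk_gmres =
  fixes N m :: nat
    and A B :: "complex mat"
    and d :: "complex vec"
    and t z v :: "nat \<Rightarrow> complex vec"
    and H :: "complex mat"
  assumes A_carrier: "A \<in> carrier_mat N N"
    and B_carrier: "B \<in> carrier_mat N N"
    and d_carrier: "d \<in> carrier_vec N"
    and d_norm_nonzero: "vnorm d \<noteq> 0"
    and t_carrier: "\<And>k. k \<in> {1..m} \<Longrightarrow> t k \<in> carrier_vec k"
    and z_carrier: "\<And>k. k \<in> {1..m} \<Longrightarrow> z k \<in> carrier_vec N"
    and v_carrier: "\<And>k. k \<in> {1..m+1} \<Longrightarrow> v k \<in> carrier_vec N"
    and H_carrier: "H \<in> carrier_mat (m + 1) m"
    and v_first: "v 1 = complex_of_real (1 / vnorm d) \<cdot>\<^sub>v d"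
    and v_orthonormal: "\<And>i j. i \<in> {1..m+1} \<Longrightarrow> j \<in> {1..m+1} \<Longrightarrow>
           v i \<bullet>c v j = (if i = j then 1 else 0)"
    and H_hessenberg: "upper_hessenberg H"
    and arnoldi: "B * cols_upto N m z = cols_upto N (m + 1) v * H"

definition inner_residual ::
  "nat \<Rightarrow> complex mat \<Rightarrow> complex mat \<Rightarrow> (nat \<Rightarrow> complex) \<Rightarrow> (nat \<Rightarrow> complex vec) \<Rightarrow>
     (nat \<Rightarrow> complex vec) \<Rightarrow> (nat \<Rightarrow> complex vec) \<Rightarrow> nat \<Rightarrow> complex vec" where
  "inner_residual N A B \<sigma> t z v k =
     cols_upto N k v *\<^sub>v t k - (A - \<sigma> k \<cdot>\<^sub>m B) *\<^sub>v z k"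

definition T_mat :: "nat \<Rightarrow> (nat \<Rightarrow> complex vec) \<Rightarrow> complex mat" where
  "T_mat m t = mat (m + 1) m (\<lambda>(i, j). if i \<le> j then t (j + 1) $ i else 0)"

definition K_mat ::
  "nat \<Rightarrow> (nat \<Rightarrow> complex) \<Rightarrow> (nat \<Rightarrow> complex vec) \<Rightarrow> complex mat \<Rightarrow> complex mat" where
  "K_mat m \<sigma> t H = H * mat_diag m (\<lambda>j. \<sigma> (j + 1)) + T_mat m t"

definition red_mat :: "complex \<Rightarrow> complex mat \<Rightarrow> complex mat \<Rightarrow> nat \<Rightarrow> complex mat" where
  "red_mat \<mu> K H k = leading (k + 1) k K - \<mu> \<cdot>\<^sub>m leading (k + 1) k H"

definition red_residual ::
  "complex \<Rightarrow> complex vec \<Rightarrow> complex mat \<Rightarrow> complex mat \<Rightarrow> nat \<Rightarrow> complex vec \<Rightarrow> complex vec" where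
  "red_residual \<mu> d K H k y =
     complex_of_real (vnorm d) \<cdot>\<^sub>v unit_vec (k + 1) 0 - red_mat \<mu> K H k *\<^sub>v y"

(* The minimizer need not be unique when the reduced matrix is rank deficient. *)
definition is_red_solution ::
  "complex \<Rightarrow> complex vec \<Rightarrow> complex mat \<Rightarrow> complex mat \<Rightarrow> nat \<Rightarrow> complex vec \<Rightarrow> bool" where
  "is_red_solution \<mu> d K H k y \<longleftrightarrow>
     is_arg_min (\<lambda>x. vnorm (red_residual \<mu> d K H k x)) (\<lambda>x. x \<in> carrier_vec k) y"

definition computed_residual ::
  "nat \<Rightarrow> complex \<Rightarrow> complex vec \<Rightarrow> (nat \<Rightarrow> complex vec) \<Rightarrow> complex mat \<Rightarrow> complex mat \<Rightarrow>
     (nat \<Rightarrow> complex vec) \<Rightarrow> nat \<Rightarrow> complex vec" where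
  "computed_residual N \<mu> d v K H y k =
     (if k = 0 then d else cols_upto N (k + 1) v *\<^sub>v red_residual \<mu> d K H k (y k))"

definition approx_solution ::
  "nat \<Rightarrow> nat \<Rightarrow> (nat \<Rightarrow> complex vec) \<Rightarrow> (nat \<Rightarrow> complex vec) \<Rightarrow> complex vec" where
  "approx_solution N m z y = cols_upto N m z *\<^sub>v y m"

definition true_residual ::
  "complex mat \<Rightarrow> complex mat \<Rightarrow> complex \<Rightarrow> complex vec \<Rightarrow> complex vec \<Rightarrow> complex vec" where
  "true_residual A B \<mu> d x = d - (A - \<mu> \<cdot>\<^sub>m B) *\<^sub>v x"

end

theory Submission
  imports Defs
begin

text \<open>
  Write \<open>M\<close> for the reduced matrix \<open>K - \<mu> H\<close>, \<open>y\<close> for the final reduced solution and \<open>P\<close> for the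
  matrix of inner residuals.  The inexact Arnoldi relation says that \<open>A - \<mu> B\<close> maps the matrix of
  search directions \<open>z\<close> to \<open>V M - P\<close>, so the true residual is the computed one plus \<open>P y\<close>
  (\<open>true_residual_eq\<close>).  It remains to bound the norm of \<open>P y\<close> by \<open>\<epsilon>\<close>, and by the triangle
  inequality this norm is at most the sum of the norms of the inner residuals, weighted by the
  absolute values of the entries of \<open>y\<close>.

  The point is that these entries decay with the computed residuals: the smallest singular value of
  \<open>M\<close> times the absolute value of the \<open>k\<close>-th entry is at most the norm of the computed residual after
  \<open>k - 1\<close> iterations (\<open>solution_entry_decay\<close>).  Indeed, by the Hessenberg shape of \<open>M\<close>, the reduced
  solution after \<open>k - 1\<close> iterations, padded by zeros to a vector \<open>x\<close>, has the same residual
  norm in the final reduced problem.  Since \<open>y\<close> solves that problem, \<open>M (y - x)\<close> is the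
  orthogonal projection of the residual at \<open>x\<close> onto the range of \<open>M\<close>
  (\<open>least_squares_projection\<close>).  Finally \<open>y - x\<close> and \<open>y\<close> agree in entry \<open>k\<close>, and the smallest
  singular value bounds the norm of \<open>M (y - x)\<close> from below (\<open>sval_min_mult_vnorm_le\<close>).  Hence each
  of the \<open>m\<close> weighted inner residuals contributes at most \<open>\<epsilon> / m\<close>.

  The lower bound by the smallest singular value rests on the fact that the infimum of the
  Rayleigh quotient of a Hermitian matrix is an eigenvalue (\<open>hermitian_least_eigenvalue\<close>).
\<close>

section \<open>Norm and real inner product of complex vectors\<close>

abbreviation re_ip :: "complex vec \<Rightarrow> complex vec \<Rightarrow> real" where
  "re_ip x y \<equiv> Re (x \<bullet>c y)"

lemma vnorm_nonneg [simp]: "0 \<le> vnorm x"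
  by (simp add: vnorm_def)

lemma norm_entry_le_vnorm: "i < dim_vec x \<Longrightarrow> cmod (x $ i) \<le> vnorm x"
  unfolding vnorm_def by (rule member_le_L2_set) auto

lemma vnorm_eq_0_iff: "x \<in> carrier_vec n \<Longrightarrow> vnorm x = 0 \<longleftrightarrow> x = 0\<^sub>v n"
  by (auto simp: vnorm_def L2_set_eq_0_iff)

lemma vnorm_triangle:
  assumes "x \<in> carrier_vec n" "y \<in> carrier_vec n"
  shows "vnorm (x + y) \<le> vnorm x + vnorm y"
proof -
  have "vnorm (x + y) \<le> L2_set (\<lambda>i. cmod (x $ i) + cmod (y $ i)) {..<n}"
    unfolding vnorm_def using assms by (auto intro!: L2_set_mono norm_triangle_ineq)
  also have "\<dots> \<le> vnorm x + vnorm y"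
    unfolding vnorm_def using assms by (auto intro: L2_set_triangle_ineq)
  finally show ?thesis .
qed

lemma vnorm_sq: "(vnorm x)\<^sup>2 = re_ip x x"
proof -
  have "(vnorm x)\<^sup>2 = (\<Sum>i<dim_vec x. (cmod (x $ i))\<^sup>2)"
    by (simp add: vnorm_def L2_set_def sum_nonneg)
  also have "\<dots> = re_ip x x"
    unfolding scalar_prod_def
    by (auto simp: Re_sum atLeast0LessThan cmod_power2 simp flip: power2_eq_square intro!: sum.cong)
  finally show ?thesis .
qed

lemma re_ip_commute:
  assumes "x \<in> carrier_vec n" "y \<in> carrier_vec n"
  shows "re_ip x y = re_ip y x"
  using assms unfolding scalar_prod_def by (auto simp: Re_sum mult.commute intro!: sum.cong)

lemma re_ip_add_left:
  assumes "x \<in> carrier_vec n" "y \<in> carrier_vec n" "u \<in> carrier_vec n"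
  shows "re_ip (x + y) u = re_ip x u + re_ip y u"
  using assms by (subst add_scalar_prod_distrib) auto

lemma re_ip_scale_left:
  assumes "x \<in> carrier_vec n" "u \<in> carrier_vec n"
  shows "re_ip (complex_of_real s \<cdot>\<^sub>v x) u = s * re_ip x u"
  using assms by (subst smult_scalar_prod_distrib) auto

lemma mult_mat_vec_adjoint:
  fixes A :: "complex mat"
  assumes "A \<in> carrier_mat p q" "x \<in> carrier_vec q" "y \<in> carrier_vec p"
  shows "(A *\<^sub>v x) \<bullet>c y = x \<bullet>c (mat_adjoint A *\<^sub>v y)"
proof -
  have "(A *\<^sub>v x) \<bullet>c y = (\<Sum>i = 0..<p. \<Sum>j = 0..<q. A $$ (i, j) * x $ j * cnj (y $ i))"
    using assms by (auto simp: scalar_prod_def sum_distrib_right intro!: sum.cong)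
  also have "\<dots> = (\<Sum>j = 0..<q. \<Sum>i = 0..<p. A $$ (i, j) * x $ j * cnj (y $ i))"
    by (rule sum.swap)
  also have "\<dots> = x \<bullet>c (mat_adjoint A *\<^sub>v y)"
    using assms
    by (auto simp: mat_adjoint_def scalar_prod_def mat_of_rows_def sum_distrib_left ac_simps
        intro!: sum.cong)
  finally show ?thesis .
qed

lemma mat_adjoint_carrier: "A \<in> carrier_mat p q \<Longrightarrow> mat_adjoint A \<in> carrier_mat q p"
  by (auto simp: mat_adjoint_def)

section \<open>Quadratic forms of Hermitian matrices\<close>

text \<open>The common source of the Cauchy-Schwarz inequalities and of the orthogonality
  of the least-squares residual: each expresses that a real parabola stays above the axis.\<close>

lemma quadratic_discriminant_le:
  fixes a b c :: real
  assumes "0 \<le> b" and nonneg: "\<And>s. 0 \<le> a + 2 * s * c + s\<^sup>2 * b"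
  shows "c\<^sup>2 \<le> a * b"
proof (cases "b = 0")
  case True
  have "c = 0"
  proof (rule ccontr)
    assume "c \<noteq> 0"
    then show False using nonneg[of "- (a + 1) / (2 * c)"] True by (simp add: field_simps)
  qed
  then show ?thesis using True by simp
next
  case False
  then have b: "b > 0" using assms by simp
  have "0 \<le> b * (a + 2 * (- c / b) * c + (- c / b)\<^sup>2 * b)"
    using nonneg[of "- c / b"] b by simp
  also have "\<dots> = a * b - c\<^sup>2"
    using b by (simp add: field_simps power2_eq_square)
  finally show ?thesis by simp
qed

text \<open>Symmetry is required of the real parts only, because all quadratic forms below are restricted
  to real lines.  Replacing \<open>y\<close> by \<open>\<i> y\<close> shows that this is the usual Hermitian property.\<close>

definition self_adjoint_mat :: "nat \<Rightarrow> complex mat \<Rightarrow> bool" where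
  "self_adjoint_mat n Q \<longleftrightarrow> Q \<in> carrier_mat n n \<and>
     (\<forall>x \<in> carrier_vec n. \<forall>y \<in> carrier_vec n. re_ip (Q *\<^sub>v x) y = re_ip x (Q *\<^sub>v y))"

lemma form_add_scaled:
  assumes Q: "Q \<in> carrier_mat n n" and x: "x \<in> carrier_vec n" and y: "y \<in> carrier_vec n"
    and sym: "re_ip (Q *\<^sub>v x) y = re_ip x (Q *\<^sub>v y)"
  shows "re_ip (Q *\<^sub>v (x + complex_of_real s \<cdot>\<^sub>v y)) (x + complex_of_real s \<cdot>\<^sub>v y)
    = re_ip (Q *\<^sub>v x) x + 2 * s * re_ip (Q *\<^sub>v x) y + s\<^sup>2 * re_ip (Q *\<^sub>v y) y"
proof -
  let ?y = "complex_of_real s \<cdot>\<^sub>v y"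
  have Qx: "Q *\<^sub>v x \<in> carrier_vec n" and Qy: "Q *\<^sub>v y \<in> carrier_vec n" using Q x y by auto
  have "Q *\<^sub>v (x + ?y) = Q *\<^sub>v x + complex_of_real s \<cdot>\<^sub>v (Q *\<^sub>v y)"
    using Q x y by (simp add: mult_add_distrib_mat_vec[of _ n n] mult_mat_vec[of _ n n])
  then have "re_ip (Q *\<^sub>v (x + ?y)) (x + ?y)
      = re_ip (Q *\<^sub>v x) (x + ?y) + s * re_ip (Q *\<^sub>v y) (x + ?y)"
    using Q x y Qx Qy by (simp add: re_ip_add_left[of _ n] re_ip_scale_left[of _ n])
  also have "\<dots> = re_ip (x + ?y) (Q *\<^sub>v x) + s * re_ip (x + ?y) (Q *\<^sub>v y)"
    using Q x y by (simp add: re_ip_commute[of "x + ?y" n])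
  also have "\<dots> = re_ip x (Q *\<^sub>v x) + s * re_ip y (Q *\<^sub>v x)
      + s * (re_ip x (Q *\<^sub>v y) + s * re_ip y (Q *\<^sub>v y))"
    using Q x y Qx Qy by (simp add: re_ip_add_left[of _ n] re_ip_scale_left[of _ n])
  also have "\<dots> = re_ip (Q *\<^sub>v x) x + 2 * s * re_ip (Q *\<^sub>v x) y + s\<^sup>2 * re_ip (Q *\<^sub>v y) y"
    using sym by (simp add: re_ip_commute[OF x Qx] re_ip_commute[OF y Qx] re_ip_commute[OF y Qy]
        algebra_simps power2_eq_square)
  finally show ?thesis .
qed

lemma psd_form_cauchy_schwarz:
  assumes Q: "self_adjoint_mat n Q"
    and psd: "\<And>x. x \<in> carrier_vec n \<Longrightarrow> 0 \<le> re_ip (Q *\<^sub>v x) x"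
    and x: "x \<in> carrier_vec n" and y: "y \<in> carrier_vec n"
  shows "(re_ip (Q *\<^sub>v x) y)\<^sup>2 \<le> re_ip (Q *\<^sub>v x) x * re_ip (Q *\<^sub>v y) y"
proof (rule quadratic_discriminant_le)
  fix s
  show "0 \<le> re_ip (Q *\<^sub>v x) x + 2 * s * re_ip (Q *\<^sub>v x) y + s\<^sup>2 * re_ip (Q *\<^sub>v y) y"
    using Q x y psd[of "x + complex_of_real s \<cdot>\<^sub>v y"] unfolding self_adjoint_mat_def
    by (subst form_add_scaled[of _ n, symmetric]) auto
qed (use psd y in auto)

lemma re_ip_le_vnorm:
  assumes x: "x \<in> carrier_vec n" and y: "y \<in> carrier_vec n"
  shows "\<bar>re_ip x y\<bar> \<le> vnorm x * vnorm y"
proof -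
  have "self_adjoint_mat n (1\<^sub>m n)"
    by (auto simp: self_adjoint_mat_def)
  then have "(re_ip x y)\<^sup>2 \<le> re_ip x x * re_ip y y"
    using psd_form_cauchy_schwarz[of n "1\<^sub>m n" x y] x y by (simp flip: vnorm_sq)
  then have "(re_ip x y)\<^sup>2 \<le> (vnorm x * vnorm y)\<^sup>2"
    by (simp add: vnorm_sq power_mult_distrib)
  then have "\<bar>re_ip x y\<bar> \<le> \<bar>vnorm x * vnorm y\<bar>" by (simp only: abs_le_square_iff)
  then show ?thesis by (simp add: abs_mult)
qed

lemma vnorm_add_scaled_sq:
  assumes x: "x \<in> carrier_vec n" and y: "y \<in> carrier_vec n"
  shows "(vnorm (x + complex_of_real s \<cdot>\<^sub>v y))\<^sup>2
    = (vnorm x)\<^sup>2 + 2 * s * re_ip x y + s\<^sup>2 * (vnorm y)\<^sup>2"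
  using form_add_scaled[of "1\<^sub>m n" n x y s] x y by (simp add: vnorm_sq)

section \<open>Matrix-vector products\<close>

lemma L2_set_sum_le:
  "L2_set (\<lambda>i. \<Sum>j\<in>J. f j i) I \<le> (\<Sum>j\<in>J. L2_set (f j) I)"
proof (induction J rule: infinite_finite_induct)
  case (insert j J)
  then show ?case
    using L2_set_triangle_ineq[of "f j" "\<lambda>i. \<Sum>j\<in>J. f j i" I] by simp
qed (auto simp: L2_set_def)

text \<open>This column-wise form of the triangle inequality keeps the size of each entry next to that of
  its column.  It is what allows inner residuals to be large where the entries of the reduced
  solution are small.\<close>

lemma vnorm_mult_mat_vec_le_cols:
  assumes A: "A \<in> carrier_mat p q" and x: "x \<in> carrier_vec q"
  shows "vnorm (A *\<^sub>v x) \<le> (\<Sum>j<q. cmod (x $ j) * vnorm (col A j))"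
proof -
  have "vnorm (A *\<^sub>v x) \<le> L2_set (\<lambda>i. \<Sum>j<q. cmod (x $ j) * cmod (A $$ (i, j))) {..<p}"
    unfolding vnorm_def using A x
    by (auto simp: scalar_prod_def atLeast0LessThan norm_mult mult.commute
        intro!: L2_set_mono sum_norm_le)
  also have "\<dots> \<le> (\<Sum>j<q. L2_set (\<lambda>i. cmod (x $ j) * cmod (A $$ (i, j))) {..<p})"
    by (rule L2_set_sum_le)
  also have "\<dots> = (\<Sum>j<q. cmod (x $ j) * vnorm (col A j))"
    unfolding vnorm_def using A
    by (auto simp: L2_set_right_distrib intro!: sum.cong L2_set_cong)
  finally show ?thesis .
qed

lemma vnorm_mult_mat_vec_bounded:
  assumes A: "A \<in> carrier_mat p q"
  obtains c where "c > 0" "\<And>x. x \<in> carrier_vec q \<Longrightarrow> vnorm (A *\<^sub>v x) \<le> c * vnorm x"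
proof
  let ?S = "\<Sum>j<q. vnorm (col A j)"
  show "?S + 1 > 0" by (simp add: sum_nonneg add_nonneg_pos)
  fix x :: "complex vec" assume x: "x \<in> carrier_vec q"
  have "vnorm (A *\<^sub>v x) \<le> (\<Sum>j<q. cmod (x $ j) * vnorm (col A j))"
    by (rule vnorm_mult_mat_vec_le_cols[OF A x])
  also have "\<dots> \<le> (\<Sum>j<q. vnorm x * vnorm (col A j))"
    using x by (intro sum_mono mult_right_mono norm_entry_le_vnorm) auto
  also have "\<dots> = ?S * vnorm x" by (simp add: sum_distrib_left mult.commute)
  finally show "vnorm (A *\<^sub>v x) \<le> (?S + 1) * vnorm x" by (simp add: distrib_right add_increasing2)
qed

section \<open>The smallest eigenvalue and the smallest singular value\<close>

text \<open>The number \<open>\<rho>\<close> is the infimum of the Rayleigh quotient, so \<open>Q = A - \<rho> I\<close> has a nonnegative form.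
  If \<open>\<rho>\<close> were not an eigenvalue, \<open>Q\<close> would be invertible.  The Cauchy-Schwarz inequality for the
  form of \<open>Q\<close> bounds the square of the norm of \<open>Q x\<close> by a multiple of the form at \<open>x\<close>, and the
  bounded inverse turns this into a positive lower bound of the Rayleigh quotient of \<open>Q\<close>,
  which contradicts the choice of \<open>\<rho>\<close>.\<close>

lemma hermitian_least_eigenvalue:
  assumes A: "self_adjoint_mat n A" and n: "n > 0"
  obtains \<rho> where "eigenvalue A (complex_of_real \<rho>)"
    "\<And>x. x \<in> carrier_vec n \<Longrightarrow> \<rho> * (vnorm x)\<^sup>2 \<le> re_ip (A *\<^sub>v x) x"
proof -
  have Ac: "A \<in> carrier_mat n n" using A by (simp add: self_adjoint_mat_def)
  define S where "S = {re_ip (A *\<^sub>v x) x / (vnorm x)\<^sup>2 | x. x \<in> carrier_vec n \<and> vnorm x \<noteq> 0}"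
  define \<rho> where "\<rho> = Inf S"
  have ne: "S \<noteq> {}"
  proof -
    have "unit_vec n 0 \<noteq> (0\<^sub>v n :: complex vec)" using n
      by (metis index_unit_vec(1) index_zero_vec(1) one_neq_zero)
    then have "vnorm (unit_vec n 0) \<noteq> 0" by (simp add: vnorm_eq_0_iff[of _ n])
    then show ?thesis unfolding S_def using unit_vec_carrier by blast
  qed
  obtain c where c: "c > 0" "\<And>x. x \<in> carrier_vec n \<Longrightarrow> vnorm (A *\<^sub>v x) \<le> c * vnorm x"
    using vnorm_mult_mat_vec_bounded[OF Ac] by blast
  have bdd: "bdd_below S"
  proof (rule bdd_belowI)
    fix r assume "r \<in> S"
    then obtain x where x: "x \<in> carrier_vec n" "vnorm x \<noteq> 0"
      and r: "r = re_ip (A *\<^sub>v x) x / (vnorm x)\<^sup>2" unfolding S_def by auto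
    have "\<bar>re_ip (A *\<^sub>v x) x\<bar> \<le> vnorm (A *\<^sub>v x) * vnorm x"
      using Ac x by (intro re_ip_le_vnorm[of _ n]) auto
    also have "\<dots> \<le> c * vnorm x * vnorm x" using c(2)[OF x(1)] by (intro mult_right_mono) auto
    finally have "- c * (vnorm x)\<^sup>2 \<le> re_ip (A *\<^sub>v x) x" by (simp add: power2_eq_square)
    then show "- c \<le> r" unfolding r using x(2) by (simp add: field_simps)
  qed
  have lower: "\<rho> * (vnorm x)\<^sup>2 \<le> re_ip (A *\<^sub>v x) x" if x: "x \<in> carrier_vec n" for x
  proof (cases "vnorm x = 0")
    case True
    then have "x = 0\<^sub>v n" using x vnorm_eq_0_iff by blast
    then show ?thesis using True Ac by simp
  next
    case False
    then have "\<rho> \<le> re_ip (A *\<^sub>v x) x / (vnorm x)\<^sup>2"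
      unfolding \<rho>_def by (intro cInf_lower[OF _ bdd]) (use x S_def in auto)
    then show ?thesis using False by (simp add: field_simps)
  qed
  define Q where "Q = A - complex_of_real \<rho> \<cdot>\<^sub>m 1\<^sub>m n"
  have Qc: "Q \<in> carrier_mat n n" unfolding Q_def using Ac by auto
  have Qx: "Q *\<^sub>v x = A *\<^sub>v x + complex_of_real (- \<rho>) \<cdot>\<^sub>v x" if "x \<in> carrier_vec n" for x
    using that Ac unfolding Q_def
    by (intro eq_vecI) (auto simp: scalar_prod_def sum_subtractf algebra_simps sum_distrib_left
        if_distrib if_distribR cong: if_cong)
  have Qform: "re_ip (Q *\<^sub>v x) y = re_ip (A *\<^sub>v x) y - \<rho> * re_ip x y"
    if "x \<in> carrier_vec n" "y \<in> carrier_vec n" for x y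
    using that Ac unfolding Qx[OF that(1)]
    by (subst re_ip_add_left[of _ n]; (subst re_ip_scale_left[of _ n])?) auto
  have Qh: "self_adjoint_mat n Q"
  proof -
    have "re_ip (Q *\<^sub>v x) y = re_ip x (Q *\<^sub>v y)"
      if x: "x \<in> carrier_vec n" and y: "y \<in> carrier_vec n" for x y
    proof -
      have "re_ip x (Q *\<^sub>v y) = re_ip (A *\<^sub>v y) x - \<rho> * re_ip y x"
        using x y Qc by (simp add: re_ip_commute[of x n "Q *\<^sub>v y"] Qform)
      also have "\<dots> = re_ip x (A *\<^sub>v y) - \<rho> * re_ip x y"
        using x y Ac by (simp add: re_ip_commute[of x n])
      finally show ?thesis using A x y by (simp add: Qform self_adjoint_mat_def)
    qed
    then show ?thesis using Qc by (simp add: self_adjoint_mat_def)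
  qed
  have psd: "0 \<le> re_ip (Q *\<^sub>v x) x" if "x \<in> carrier_vec n" for x
    using lower[OF that] that by (simp add: Qform vnorm_sq)
  have "eigenvalue A (complex_of_real \<rho>)"
  proof (rule ccontr)
    assume not: "\<not> eigenvalue A (complex_of_real \<rho>)"
    have "char_matrix A (complex_of_real \<rho>) = Q"
      unfolding char_matrix_def Q_def using Ac by (auto intro!: eq_matI)
    then have "det Q \<noteq> 0" using not eigenvalue_det[OF Ac] by simp
    from det_non_zero_imp_unit[OF Qc this, unfolded Units_def, of "()"]
    obtain R where Rc: "R \<in> carrier_mat n n" and RQ: "R * Q = 1\<^sub>m n"
      by (auto simp: ring_mat_def)
    obtain r where r: "r > 0" "\<And>x. x \<in> carrier_vec n \<Longrightarrow> vnorm (R *\<^sub>v x) \<le> r * vnorm x"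
      using vnorm_mult_mat_vec_bounded[OF Rc] by blast
    obtain q where q: "q > 0" "\<And>x. x \<in> carrier_vec n \<Longrightarrow> vnorm (Q *\<^sub>v x) \<le> q * vnorm x"
      using vnorm_mult_mat_vec_bounded[OF Qc] by blast
    have coercive: "(vnorm x)\<^sup>2 \<le> r\<^sup>2 * q * re_ip (Q *\<^sub>v x) x" if x: "x \<in> carrier_vec n" for x
    proof -
      let ?y = "Q *\<^sub>v x"
      have y: "?y \<in> carrier_vec n" using Qc x by auto
      have "x = R *\<^sub>v ?y"
        using x Qc Rc RQ by (simp flip: assoc_mult_mat_vec[OF Rc Qc x])
      then have "vnorm x \<le> r * vnorm ?y" using r(2)[OF y] by simp
      then have 1: "(vnorm x)\<^sup>2 \<le> r\<^sup>2 * (vnorm ?y)\<^sup>2"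
        by (metis power_mono power_mult_distrib vnorm_nonneg)
      have "((vnorm ?y)\<^sup>2)\<^sup>2 \<le> re_ip ?y x * re_ip (Q *\<^sub>v ?y) ?y"
        using psd_form_cauchy_schwarz[OF Qh psd x y] by (simp add: vnorm_sq)
      also have "\<dots> \<le> re_ip ?y x * (q * (vnorm ?y)\<^sup>2)"
      proof (rule mult_left_mono[OF _ psd[OF x]])
        have "re_ip (Q *\<^sub>v ?y) ?y \<le> vnorm (Q *\<^sub>v ?y) * vnorm ?y"
          using re_ip_le_vnorm[of "Q *\<^sub>v ?y" n ?y] y Qc by auto
        also have "\<dots> \<le> q * vnorm ?y * vnorm ?y"
          using q(2)[OF y] by (intro mult_right_mono) auto
        finally show "re_ip (Q *\<^sub>v ?y) ?y \<le> q * (vnorm ?y)\<^sup>2" by (simp add: power2_eq_square)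
      qed
      finally have 2: "(vnorm ?y)\<^sup>2 * (vnorm ?y)\<^sup>2 \<le> (q * re_ip ?y x) * (vnorm ?y)\<^sup>2"
        by (simp add: power2_eq_square algebra_simps)
      have "(vnorm ?y)\<^sup>2 \<le> q * re_ip ?y x"
      proof (cases "vnorm ?y = 0")
        case True
        then show ?thesis using psd[OF x] q(1) by simp
      next
        case False
        then have "0 < (vnorm ?y)\<^sup>2" by simp
        with 2 show ?thesis by (rule mult_right_le_imp_le)
      qed
      then have "r\<^sup>2 * (vnorm ?y)\<^sup>2 \<le> r\<^sup>2 * (q * re_ip ?y x)" by (intro mult_left_mono) auto
      then show ?thesis using 1 by (simp add: algebra_simps)
    qed
    have "\<rho> + 1 / (r\<^sup>2 * q) \<le> Inf S"
    proof (rule cInf_greatest[OF ne])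
      fix s assume "s \<in> S"
      then obtain x where x: "x \<in> carrier_vec n" "vnorm x \<noteq> 0"
        and s: "s = re_ip (A *\<^sub>v x) x / (vnorm x)\<^sup>2" unfolding S_def by auto
      have "(vnorm x)\<^sup>2 \<le> r\<^sup>2 * q * (re_ip (A *\<^sub>v x) x - \<rho> * (vnorm x)\<^sup>2)"
        using coercive[OF x(1)] x(1) by (simp add: Qform vnorm_sq)
      then have "(1 / (r\<^sup>2 * q)) * (vnorm x)\<^sup>2 \<le> re_ip (A *\<^sub>v x) x - \<rho> * (vnorm x)\<^sup>2"
        using r(1) q(1) by (simp add: field_simps)
      then have "(\<rho> + 1 / (r\<^sup>2 * q)) * (vnorm x)\<^sup>2 \<le> re_ip (A *\<^sub>v x) x"
        by (simp add: algebra_simps)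
      then show "\<rho> + 1 / (r\<^sup>2 * q) \<le> s" unfolding s using x(2) by (subst pos_le_divide_eq) auto
    qed
    then show False unfolding \<rho>_def[symmetric] using r(1) q(1) by (simp add: mult_le_0_iff)
  qed
  then show thesis using lower that by blast
qed

lemma gram_form:
  assumes M: "M \<in> carrier_mat p q" and x: "x \<in> carrier_vec q" and y: "y \<in> carrier_vec q"
  shows "re_ip ((mat_adjoint M * M) *\<^sub>v x) y = re_ip (M *\<^sub>v x) (M *\<^sub>v y)"
proof -
  note M' = mat_adjoint_carrier[OF M]
  have "re_ip ((mat_adjoint M * M) *\<^sub>v x) y = re_ip y (mat_adjoint M *\<^sub>v (M *\<^sub>v x))"
    using M M' x y by (subst re_ip_commute[of _ q]) auto
  also have "\<dots> = re_ip (M *\<^sub>v y) (M *\<^sub>v x)"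
    using M x y by (simp add: mult_mat_vec_adjoint)
  also have "\<dots> = re_ip (M *\<^sub>v x) (M *\<^sub>v y)"
    using M x y by (intro re_ip_commute[of _ p]) auto
  finally show ?thesis .
qed

text \<open>The squares of the singular values are the eigenvalues of the Gram matrix, and the form of the Gram
  matrix at \<open>x\<close> is the squared norm of \<open>M x\<close>.\<close>

lemma sval_min_mult_vnorm_le:
  assumes M: "M \<in> carrier_mat p q" and "q \<le> p" and x: "x \<in> carrier_vec q"
  shows "sval_min M * vnorm x \<le> vnorm (M *\<^sub>v x)"
proof (cases "q = 0")
  case True
  then have "vnorm x = 0" using x by (simp add: vnorm_def)
  then show ?thesis by simp
next
  case False
  let ?G = "mat_adjoint M * M"
  have G: "?G \<in> carrier_mat q q" using M mat_adjoint_carrier[OF M] by auto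
  have "self_adjoint_mat q ?G"
    unfolding self_adjoint_mat_def
  proof (intro conjI ballI G)
    fix u w :: "complex vec" assume u: "u \<in> carrier_vec q" and w: "w \<in> carrier_vec q"
    have "re_ip u (?G *\<^sub>v w) = re_ip (?G *\<^sub>v w) u"
      using u w G by (intro re_ip_commute[of _ q]) auto
    also have "\<dots> = re_ip (M *\<^sub>v u) (M *\<^sub>v w)"
      using M u w by (simp only: gram_form[OF M w u]) (intro re_ip_commute[of _ p], auto)
    finally show "re_ip (?G *\<^sub>v u) w = re_ip u (?G *\<^sub>v w)" by (simp only: gram_form[OF M u w])
  qed
  then obtain \<rho> where ev: "eigenvalue ?G (complex_of_real \<rho>)"
    and low: "\<And>x. x \<in> carrier_vec q \<Longrightarrow> \<rho> * (vnorm x)\<^sup>2 \<le> re_ip (?G *\<^sub>v x) x"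
    using hermitian_least_eigenvalue False by blast
  have "sval_min M \<le> sqrt \<rho>"
    unfolding sval_min_def singular_values_def
  proof (rule Min_le)
    show "finite ((\<lambda>l. sqrt (Re l)) ` spectrum (if dim_col M \<le> dim_row M then ?G
        else M * mat_adjoint M))"
      using M \<open>q \<le> p\<close> card_finite_spectrum(1)[OF G] by auto
    show "sqrt \<rho> \<in> (\<lambda>l. sqrt (Re l)) ` spectrum (if dim_col M \<le> dim_row M then ?G
        else M * mat_adjoint M)"
      using M \<open>q \<le> p\<close> ev by (auto simp: spectrum_def intro!: image_eqI[of _ _ "complex_of_real \<rho>"])
  qed
  then have "sval_min M * vnorm x \<le> sqrt \<rho> * vnorm x" by (simp add: mult_right_mono)
  also have "\<dots> \<le> vnorm (M *\<^sub>v x)"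
  proof -
    have "sqrt \<rho> * vnorm x = sqrt (\<rho> * (vnorm x)\<^sup>2)" by (simp add: real_sqrt_mult)
    also have "\<dots> \<le> sqrt ((vnorm (M *\<^sub>v x))\<^sup>2)"
      using low[OF x] unfolding gram_form[OF M x x] vnorm_sq[symmetric]
      by (rule real_sqrt_le_mono)
    finally show ?thesis by simp
  qed
  finally show ?thesis .
qed

section \<open>Least squares\<close>

text \<open>Minimality along the real line through \<open>y\<close> and \<open>x\<close> makes the optimal residual orthogonal
  to \<open>M (y - x)\<close>, so the vector \<open>M (y - x)\<close> is one leg of a right triangle whose hypotenuse
  is the residual at \<open>x\<close>.\<close>

lemma least_squares_projection:
  assumes b: "b \<in> carrier_vec p" and M: "M \<in> carrier_mat p q"
    and y: "y \<in> carrier_vec q" and x: "x \<in> carrier_vec q"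
    and minimal: "\<And>u. u \<in> carrier_vec q \<Longrightarrow> vnorm (b - M *\<^sub>v y) \<le> vnorm (b - M *\<^sub>v u)"
  shows "vnorm (M *\<^sub>v (y - x)) \<le> vnorm (b - M *\<^sub>v x)"
proof -
  define e where "e = b - M *\<^sub>v y"
  define w where "w = M *\<^sub>v (y - x)"
  have e: "e \<in> carrier_vec p" and w: "w \<in> carrier_vec p"
    unfolding e_def w_def using b M x y by auto
  \<comment> \<open>The residuals along the real line through \<open>y\<close> and \<open>x\<close>, with \<open>s = 1\<close> at \<open>x\<close>.\<close>
  have line: "b - M *\<^sub>v (y - complex_of_real s \<cdot>\<^sub>v (y - x)) = e + complex_of_real s \<cdot>\<^sub>v w" for s
  proof -
    have "M *\<^sub>v (y - complex_of_real s \<cdot>\<^sub>v (y - x)) = M *\<^sub>v y - complex_of_real s \<cdot>\<^sub>v w"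
      unfolding w_def using M x y
      by (simp add: mult_minus_distrib_mat_vec[of _ p q] mult_mat_vec[of _ p q])
    then show ?thesis unfolding e_def using b M y w by (intro eq_vecI) auto
  qed
  have "(re_ip e w)\<^sup>2 \<le> 0 * (vnorm w)\<^sup>2"
  proof (rule quadratic_discriminant_le)
    fix s
    have "vnorm e \<le> vnorm (e + complex_of_real s \<cdot>\<^sub>v w)"
      using minimal[of "y - complex_of_real s \<cdot>\<^sub>v (y - x)"] x y
      unfolding line unfolding e_def by simp
    then have "(vnorm e)\<^sup>2 \<le> (vnorm (e + complex_of_real s \<cdot>\<^sub>v w))\<^sup>2"
      by (simp add: power_mono)
    then show "0 \<le> 0 + 2 * s * re_ip e w + s\<^sup>2 * (vnorm w)\<^sup>2"
      by (simp add: vnorm_add_scaled_sq[OF e w])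
  qed simp
  then have orth: "re_ip e w = 0" by simp
  have "y - complex_of_real 1 \<cdot>\<^sub>v (y - x) = x"
    using x y by (intro eq_vecI) auto
  then have "(vnorm (b - M *\<^sub>v x))\<^sup>2 = (vnorm e)\<^sup>2 + (vnorm w)\<^sup>2"
    using line[of 1] vnorm_add_scaled_sq[OF e w, of 1] orth by simp
  then have "(vnorm w)\<^sup>2 \<le> (vnorm (b - M *\<^sub>v x))\<^sup>2" by simp
  then show ?thesis unfolding w_def by (rule power2_le_imp_le) simp
qed

section \<open>The inexact Arnoldi relation\<close>

lemma cols_upto_carrier [simp]: "cols_upto N k x \<in> carrier_mat N k"
  unfolding cols_upto_def carrier_mat_def by (simp del: upt_Suc)

lemma dim_cols_upto [simp]: "dim_row (cols_upto N k x) = N" "dim_col (cols_upto N k x) = k"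
  using cols_upto_carrier[of N k x] by (simp_all only: carrier_matD)

lemma col_cols_upto:
  assumes "j < k" "x (j + 1) \<in> carrier_vec N"
  shows "col (cols_upto N k x) j = x (j + 1)"
  using assms unfolding cols_upto_def by (subst col_mat_of_cols) (auto simp del: upt_Suc)

lemma cols_upto_index: "i < N \<Longrightarrow> j < k \<Longrightarrow> cols_upto N k x $$ (i, j) = x (j + 1) $ i"
  unfolding cols_upto_def by (subst mat_of_cols_index) (auto simp del: upt_Suc)

lemma K_mat_carrier: "H \<in> carrier_mat (m + 1) m \<Longrightarrow> K_mat m \<sigma> t H \<in> carrier_mat (m + 1) m"
  unfolding K_mat_def T_mat_def by auto

lemma K_mat_minus_index:
  assumes H: "H \<in> carrier_mat (m + 1) m" and "i < m + 1" "j < m"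
  shows "(K_mat m \<sigma> t H - \<mu> \<cdot>\<^sub>m H) $$ (i, j)
    = (\<sigma> (j + 1) - \<mu>) * H $$ (i, j) + (if i \<le> j then t (j + 1) $ i else 0)"
  using assms unfolding K_mat_def T_mat_def
  by (subst mat_diag_mult_right[OF H]) (auto simp: algebra_simps)

lemma cols_upto_mult_padded:
  assumes "k \<le> n" "w \<in> carrier_vec k"
  shows "cols_upto N n x *\<^sub>v vec n (\<lambda>i. if i < k then w $ i else 0) = cols_upto N k x *\<^sub>v w"
proof (intro eq_vecI)
  fix i assume "i < dim_vec (cols_upto N k x *\<^sub>v w)"
  then have i: "i < N" by simp
  have "(cols_upto N n x *\<^sub>v vec n (\<lambda>i. if i < k then w $ i else 0)) $ i
      = (\<Sum>j = 0..<n. if j < k then x (j + 1) $ i * w $ j else 0)"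
    using i by (auto simp: scalar_prod_def cols_upto_index intro!: sum.cong)
  also have "\<dots> = (\<Sum>j = 0..<k. x (j + 1) $ i * w $ j)"
    using \<open>k \<le> n\<close> by (intro sum.mono_neutral_cong_right) auto
  also have "\<dots> = (cols_upto N k x *\<^sub>v w) $ i"
    using i assms by (auto simp: scalar_prod_def cols_upto_index intro!: sum.cong)
  finally show "(cols_upto N n x *\<^sub>v vec n (\<lambda>i. if i < k then w $ i else 0)) $ i
      = (cols_upto N k x *\<^sub>v w) $ i" .
qed auto

lemma red_mat_carrier: "red_mat \<mu> K H k \<in> carrier_mat (k + 1) k"
  by (auto simp: red_mat_def leading_def)

lemma red_residual_carrier: "red_residual \<mu> d K H k x \<in> carrier_vec (k + 1)"
  by (intro carrier_vecI) (simp add: red_residual_def red_mat_def leading_def)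

lemma vnorm_padded:
  assumes "k \<le> n" "x \<in> carrier_vec k"
  shows "vnorm (vec n (\<lambda>i. if i < k then x $ i else 0)) = vnorm x"
proof -
  have "(\<Sum>i<n. (cmod (if i < k then x $ i else 0))\<^sup>2) = (\<Sum>i<k. (cmod (x $ i))\<^sup>2)"
    using assms by (intro sum.mono_neutral_cong_right) auto
  then show ?thesis using assms by (simp add: vnorm_def L2_set_def)
qed

context inexact_rrk_gmres
begin

lemma vnorm_basis_mult:
  assumes k: "k \<le> m + 1" and w: "w \<in> carrier_vec k"
  shows "vnorm (cols_upto N k v *\<^sub>v w) = vnorm w"
proof -
  let ?V = "cols_upto N k v"
  have "mat_adjoint ?V * ?V = 1\<^sub>m k"
  proof (intro eq_matI)
    fix i j assume "i < dim_row (1\<^sub>m k :: complex mat)" "j < dim_col (1\<^sub>m k :: complex mat)"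
    then have ij: "i < k" "j < k" by auto
    have v: "v (i + 1) \<in> carrier_vec N" "v (j + 1) \<in> carrier_vec N"
      using v_carrier ij k by auto
    have "(mat_adjoint ?V * ?V) $$ (i, j) = row (mat_adjoint ?V) i \<bullet> col ?V j"
      using ij mat_adjoint_carrier[OF cols_upto_carrier, of N k v] by simp
    also have "row (mat_adjoint ?V) i = conjugate (v (i + 1))"
      unfolding mat_adjoint_def using ij v by (subst mat_of_rows_row) (auto simp: col_cols_upto)
    also have "col ?V j = v (j + 1)" using ij v by (simp add: col_cols_upto)
    also have "conjugate (v (i + 1)) \<bullet> v (j + 1) = v (j + 1) \<bullet>c v (i + 1)"
      using v by (simp add: conjugate_vec_sprod_comm)
    also have "\<dots> = (1\<^sub>m k) $$ (i, j)"
      using ij k by (simp add: v_orthonormal)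
    finally show "(mat_adjoint ?V * ?V) $$ (i, j) = (1\<^sub>m k) $$ (i, j)" .
  qed (use mat_adjoint_carrier[OF cols_upto_carrier, of N k v] in auto)
  then have "(vnorm (?V *\<^sub>v w))\<^sup>2 = (vnorm w)\<^sup>2"
    using gram_form[OF cols_upto_carrier w w, of N v] w by (simp add: vnorm_sq)
  then show ?thesis by simp
qed

lemma rhs_in_basis:
  "cols_upto N (m + 1) v *\<^sub>v (complex_of_real (vnorm d) \<cdot>\<^sub>v unit_vec (m + 1) 0) = d"
proof -
  have v1: "v 1 \<in> carrier_vec N" using v_carrier by simp
  have "cols_upto N (m + 1) v *\<^sub>v unit_vec (m + 1) 0 = v 1"
    using v1 col_cols_upto[of 0 "m + 1" v N] by (intro eq_vecI) (auto simp: cols_upto_index)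
  then have "cols_upto N (m + 1) v *\<^sub>v (complex_of_real (vnorm d) \<cdot>\<^sub>v unit_vec (m + 1) 0)
      = complex_of_real (vnorm d) \<cdot>\<^sub>v v 1"
    by (simp add: mult_mat_vec[of _ N "m + 1"])
  also have "\<dots> = d"
    unfolding v_first using d_norm_nonzero by (intro eq_vecI) auto
  finally show ?thesis .
qed

lemma inner_residual_carrier:
  assumes "k \<in> {1..m}"
  shows "inner_residual N A B \<sigma> t z v k \<in> carrier_vec N"
  using A_carrier B_carrier unfolding inner_residual_def
  by (intro minus_carrier_vec mult_mat_vec_carrier[of _ _ N] mult_mat_vec_carrier[of _ _ k]
      t_carrier[OF assms] z_carrier[OF assms]) auto

text \<open>Writing \<open>A - \<mu> B = (A - \<sigma> B) + (\<sigma> - \<mu>) B\<close>, the first part applied to the new vector is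
  the combination of basis vectors given by \<open>t\<close> up to the inner residual, and the second part is
  given by the column of \<open>H\<close>.\<close>

lemma shifted_mult_z:
  assumes j: "j < m"
  shows "(A - \<mu> \<cdot>\<^sub>m B) *\<^sub>v z (j + 1)
    = cols_upto N (m + 1) v *\<^sub>v col (K_mat m \<sigma> t H - \<mu> \<cdot>\<^sub>m H) j
      - inner_residual N A B \<sigma> t z v (j + 1)"
proof -
  let ?V = "cols_upto N (m + 1) v" and ?k = "j + 1"
  have k: "?k \<in> {1..m}" using j by simp
  note z = z_carrier[OF k] and t = t_carrier[OF k]
  let ?t = "vec (m + 1) (\<lambda>i. if i < ?k then t ?k $ i else 0)"
  have "col (K_mat m \<sigma> t H - \<mu> \<cdot>\<^sub>m H) j = (\<sigma> ?k - \<mu>) \<cdot>\<^sub>v col H j + ?t"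
    using H_carrier K_mat_carrier[OF H_carrier, of \<sigma> t] j
    by (intro eq_vecI) (auto simp: K_mat_minus_index[OF H_carrier] simp del: index_minus_mat(1))
  then have "?V *\<^sub>v col (K_mat m \<sigma> t H - \<mu> \<cdot>\<^sub>m H) j
      = (\<sigma> ?k - \<mu>) \<cdot>\<^sub>v (?V *\<^sub>v col H j) + ?V *\<^sub>v ?t"
    using col_carrier_vec[OF j H_carrier]
    by (simp add: mult_add_distrib_mat_vec[of _ N "Suc m"] mult_mat_vec[of _ N "Suc m"])
  also have "?V *\<^sub>v ?t = cols_upto N ?k v *\<^sub>v t ?k"
    using cols_upto_mult_padded[of ?k "m + 1" "t ?k" N v] t j by simp
  also have "?V *\<^sub>v col H j = B *\<^sub>v z ?k"
  proof -
    have "?V *\<^sub>v col H j = col (?V * H) j"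
      using H_carrier j by (subst col_mult2[of _ N "m + 1" _ m]) auto
    also have "\<dots> = B *\<^sub>v col (cols_upto N m z) j"
      unfolding arnoldi[symmetric] using B_carrier j by (subst col_mult2[of _ N N _ m]) auto
    finally show ?thesis using j z by (simp add: col_cols_upto)
  qed
  finally have V: "?V *\<^sub>v col (K_mat m \<sigma> t H - \<mu> \<cdot>\<^sub>m H) j
      = (\<sigma> ?k - \<mu>) \<cdot>\<^sub>v (B *\<^sub>v z ?k) + cols_upto N ?k v *\<^sub>v t ?k" .
  have shift: "(A - s \<cdot>\<^sub>m B) *\<^sub>v z ?k = A *\<^sub>v z ?k - s \<cdot>\<^sub>v (B *\<^sub>v z ?k)" for s
    using A_carrier B_carrier z by (subst minus_mult_distrib_mat_vec[of _ N N]) auto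
  show ?thesis
    unfolding V inner_residual_def shift using A_carrier B_carrier z t
    by (intro eq_vecI) (auto simp: algebra_simps)
qed

lemma inexact_arnoldi_relation:
  "(A - \<mu> \<cdot>\<^sub>m B) * cols_upto N m z
    = cols_upto N (m + 1) v * (K_mat m \<sigma> t H - \<mu> \<cdot>\<^sub>m H)
      - cols_upto N m (inner_residual N A B \<sigma> t z v)" (is "?L = ?V * ?M - ?P")
proof -
  have M: "?M \<in> carrier_mat (m + 1) m" using H_carrier K_mat_carrier[OF H_carrier] by auto
  have AB: "A - \<mu> \<cdot>\<^sub>m B \<in> carrier_mat N N" using A_carrier B_carrier by auto
  have "col ?L j = col (?V * ?M - ?P) j" if j: "j < m" for j
  proof -
    have "col ?L j = (A - \<mu> \<cdot>\<^sub>m B) *\<^sub>v z (j + 1)"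
      using j AB z_carrier[of "j + 1"] by (subst col_mult2[of _ N N _ m]) (auto simp: col_cols_upto)
    also have "\<dots> = col (?V * ?M) j - col ?P j"
      unfolding shifted_mult_z[OF j, of \<mu> \<sigma>]
      using j M inner_residual_carrier[of "j + 1"]
      by (subst col_mult2[of _ N "m + 1" _ m]) (auto simp: col_cols_upto)
    also have "\<dots> = col (?V * ?M - ?P) j"
      using j M by (intro eq_vecI) auto
    finally show ?thesis .
  qed
  then show ?thesis using AB M by (intro mat_col_eqI) auto
qed

lemma red_mat_full: "red_mat \<mu> (K_mat m \<sigma> t H) H m = K_mat m \<sigma> t H - \<mu> \<cdot>\<^sub>m H"
  using K_mat_carrier[OF H_carrier, of \<sigma> t] H_carrier
  unfolding red_mat_def leading_def by (intro eq_matI) auto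

lemma true_residual_eq:
  assumes y: "y m \<in> carrier_vec m" and m: "m \<ge> 1"
  shows "true_residual A B \<mu> d (approx_solution N m z y)
    = computed_residual N \<mu> d v (K_mat m \<sigma> t H) H y m
      + cols_upto N m (inner_residual N A B \<sigma> t z v) *\<^sub>v y m"
proof -
  let ?V = "cols_upto N (m + 1) v" and ?M = "K_mat m \<sigma> t H - \<mu> \<cdot>\<^sub>m H"
    and ?P = "cols_upto N m (inner_residual N A B \<sigma> t z v)"
  let ?\<beta>e = "complex_of_real (vnorm d) \<cdot>\<^sub>v unit_vec (m + 1) 0"
  have M: "?M \<in> carrier_mat (m + 1) m" using H_carrier K_mat_carrier[OF H_carrier] by auto
  have AB: "A - \<mu> \<cdot>\<^sub>m B \<in> carrier_mat N N" using A_carrier B_carrier by auto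
  have VM: "?V * ?M \<in> carrier_mat N m" using M by (meson cols_upto_carrier mult_carrier_mat)
  have "(A - \<mu> \<cdot>\<^sub>m B) *\<^sub>v (cols_upto N m z *\<^sub>v y m) = (?V * ?M - ?P) *\<^sub>v y m"
    unfolding inexact_arnoldi_relation[symmetric]
    by (rule assoc_mult_mat_vec[symmetric, OF AB cols_upto_carrier y])
  also have "\<dots> = (?V * ?M) *\<^sub>v y m - ?P *\<^sub>v y m"
    by (rule minus_mult_distrib_mat_vec[OF VM cols_upto_carrier y])
  also have "(?V * ?M) *\<^sub>v y m = ?V *\<^sub>v (?M *\<^sub>v y m)"
    by (rule assoc_mult_mat_vec[OF cols_upto_carrier M y])
  finally have 1: "true_residual A B \<mu> d (approx_solution N m z y)
      = d - (?V *\<^sub>v (?M *\<^sub>v y m) - ?P *\<^sub>v y m)"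
    by (simp add: true_residual_def approx_solution_def)
  have "computed_residual N \<mu> d v (K_mat m \<sigma> t H) H y m = ?V *\<^sub>v (?\<beta>e - ?M *\<^sub>v y m)"
    using m by (simp add: computed_residual_def red_residual_def red_mat_full)
  also have "\<dots> = d - ?V *\<^sub>v (?M *\<^sub>v y m)"
    using M y by (subst mult_minus_distrib_mat_vec[of _ N "m + 1"]) (auto simp: rhs_in_basis[simplified])
  finally have 2: "computed_residual N \<mu> d v (K_mat m \<sigma> t H) H y m = d - ?V *\<^sub>v (?M *\<^sub>v y m)" .
  show ?thesis unfolding 1 2 using d_carrier by (intro eq_vecI) auto
qed

section \<open>Residuals of the earlier reduced problems\<close>

lemma K_mat_minus_hessenberg:
  assumes "i < m + 1" "j < m" "j + 1 < i"
  shows "(K_mat m \<sigma> t H - \<mu> \<cdot>\<^sub>m H) $$ (i, j) = 0"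
  using assms H_hessenberg H_carrier
  by (subst K_mat_minus_index[OF H_carrier]) (auto simp: upper_hessenberg_def)

text \<open>By the Hessenberg shape, the first \<open>k\<close> columns vanish below row \<open>k + 1\<close>, so an early reduced problem
  is the restriction of the final one to vectors supported on the first \<open>k\<close> entries.\<close>

lemma red_residual_padded:
  assumes k: "k \<le> m" and x: "x \<in> carrier_vec k"
  shows "red_residual \<mu> d (K_mat m \<sigma> t H) H m (vec m (\<lambda>i. if i < k then x $ i else 0))
    = vec (m + 1) (\<lambda>i. if i < k + 1 then red_residual \<mu> d (K_mat m \<sigma> t H) H k x $ i else 0)"
    (is "red_residual \<mu> d ?K H m ?x = _")
proof (intro eq_vecI)
  let ?M = "?K - \<mu> \<cdot>\<^sub>m H"
  have K: "?K \<in> carrier_mat (m + 1) m" by (rule K_mat_carrier[OF H_carrier])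
  fix i assume "i < dim_vec (vec (m + 1)
    (\<lambda>i. if i < k + 1 then red_residual \<mu> d ?K H k x $ i else 0))"
  then have i: "i < m + 1" by simp
  have "(?M *\<^sub>v ?x) $ i = (\<Sum>j = 0..<m. if j < k then ?M $$ (i, j) * x $ j else 0)"
    using i H_carrier K by (auto simp: scalar_prod_def intro!: sum.cong)
  also have "\<dots> = (\<Sum>j = 0..<k. ?M $$ (i, j) * x $ j)"
    using k by (intro sum.mono_neutral_cong_right) auto
  finally have Mx: "(?M *\<^sub>v ?x) $ i = (\<Sum>j = 0..<k. ?M $$ (i, j) * x $ j)" .
  have full: "red_residual \<mu> d ?K H m ?x $ i
      = (if i = 0 then complex_of_real (vnorm d) else 0) - (?M *\<^sub>v ?x) $ i"
    using i H_carrier K unfolding red_residual_def red_mat_full by auto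
  show "red_residual \<mu> d ?K H m ?x $ i = vec (m + 1)
    (\<lambda>i. if i < k + 1 then red_residual \<mu> d ?K H k x $ i else 0) $ i"
  proof (cases "i < k + 1")
    case True
    have "(red_mat \<mu> ?K H k *\<^sub>v x) $ i = (\<Sum>j = 0..<k. ?M $$ (i, j) * x $ j)"
      using True i k x H_carrier K
      by (auto simp: scalar_prod_def red_mat_def leading_def intro!: sum.cong)
    then have "red_residual \<mu> d ?K H k x $ i
        = (if i = 0 then complex_of_real (vnorm d) else 0) - (\<Sum>j = 0..<k. ?M $$ (i, j) * x $ j)"
      using True red_mat_carrier[of \<mu> ?K H k] unfolding red_residual_def by auto
    then show ?thesis using full Mx True i by simp
  next
    case False
    have "(\<Sum>j = 0..<k. ?M $$ (i, j) * x $ j) = 0"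
    proof (rule sum.neutral, rule ballI)
      fix j assume "j \<in> {0..<k}"
      then have "?M $$ (i, j) = 0" using False i k by (intro K_mat_minus_hessenberg) auto
      then show "?M $$ (i, j) * x $ j = 0" by simp
    qed
    then show ?thesis using full Mx False i by simp
  qed
qed (auto simp: red_residual_def red_mat_def leading_def)

text \<open>For \<open>k = 0\<close> the vector \<open>y 0\<close> is arbitrary; the zero vector of the full problem then takes the place of
  the padded one, since its residual has the norm of \<open>d\<close>.\<close>

lemma computed_residual_as_full_red_residual:
  assumes k: "k \<le> m" and y: "k \<noteq> 0 \<Longrightarrow> y k \<in> carrier_vec k"
  obtains x where "x \<in> carrier_vec m" "\<And>i. k \<le> i \<Longrightarrow> i < m \<Longrightarrow> x $ i = 0"
    "vnorm (red_residual \<mu> d (K_mat m \<sigma> t H) H m x)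
      = vnorm (computed_residual N \<mu> d v (K_mat m \<sigma> t H) H y k)"
proof
  let ?K = "K_mat m \<sigma> t H"
  define w where "w = (if k = 0 then 0\<^sub>v 0 else y k)"
  have w: "w \<in> carrier_vec k" using y by (auto simp: w_def)
  let ?x = "vec m (\<lambda>i. if i < k then w $ i else 0)"
  show "?x \<in> carrier_vec m" by simp
  show "?x $ i = 0" if "k \<le> i" "i < m" for i using that by simp
  have "vnorm (red_residual \<mu> d ?K H m ?x) = vnorm (red_residual \<mu> d ?K H k w)"
    using vnorm_padded[OF _ red_residual_carrier, of k "m + 1"] k
    unfolding red_residual_padded[OF k w] by simp
  also have "\<dots> = vnorm (computed_residual N \<mu> d v ?K H y k)"
  proof (cases "k = 0")
    case True
    have "red_residual \<mu> d ?K H 0 w = complex_of_real (vnorm d) \<cdot>\<^sub>v unit_vec 1 0"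
      using w True unfolding red_residual_def red_mat_def leading_def
      by (intro eq_vecI) (auto simp: scalar_prod_def)
    moreover have "vnorm (complex_of_real (vnorm d) \<cdot>\<^sub>v unit_vec 1 0) = \<bar>vnorm d\<bar>"
      by (simp only: vnorm_def[of "_ \<cdot>\<^sub>v _"]) (simp add: L2_set_def)
    ultimately show ?thesis using True by (simp add: computed_residual_def)
  next
    case False
    then show ?thesis using k vnorm_basis_mult[OF _ red_residual_carrier]
      by (simp add: computed_residual_def w_def)
  qed
  finally show "vnorm (red_residual \<mu> d ?K H m ?x)
      = vnorm (computed_residual N \<mu> d v ?K H y k)" .
qed

text \<open>The key estimate.  Let \<open>x\<close> be the vector \<open>y k\<close>, padded by zeros, or zero
  if \<open>k = 0\<close>.  Entry \<open>k\<close> of the final solution \<open>y m\<close>, counted from zero, is also entry \<open>k\<close> of \<open>y m - x\<close>.  The norm of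
  \<open>M (y m - x)\<close> is at most that of the residual at \<open>x\<close>, which has the norm of the computed residual
  after \<open>k\<close> iterations, and at least the smallest singular value times the norm of \<open>y m - x\<close>.\<close>

lemma solution_entry_decay:
  assumes ym: "is_red_solution \<mu> d (K_mat m \<sigma> t H) H m (y m)"
    and k: "k < m" and yk: "k \<noteq> 0 \<Longrightarrow> y k \<in> carrier_vec k"
  shows "sval_min (K_mat m \<sigma> t H - \<mu> \<cdot>\<^sub>m H) * cmod (y m $ k)
    \<le> vnorm (computed_residual N \<mu> d v (K_mat m \<sigma> t H) H y k)"
proof -
  let ?K = "K_mat m \<sigma> t H" and ?b = "complex_of_real (vnorm d) \<cdot>\<^sub>v unit_vec (m + 1) 0"
  let ?M = "?K - \<mu> \<cdot>\<^sub>m H"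
  have M: "?M \<in> carrier_mat (m + 1) m" using H_carrier K_mat_carrier[OF H_carrier] by auto
  have full: "red_residual \<mu> d ?K H m x = ?b - ?M *\<^sub>v x" for x
    by (simp add: red_residual_def red_mat_full)
  have y: "y m \<in> carrier_vec m"
    and minimal: "\<And>u. u \<in> carrier_vec m \<Longrightarrow> vnorm (?b - ?M *\<^sub>v y m) \<le> vnorm (?b - ?M *\<^sub>v u)"
    using ym unfolding is_red_solution_def is_arg_min_def full by (auto simp: not_less)
  obtain x where x: "x \<in> carrier_vec m" and x0: "\<And>i. k \<le> i \<Longrightarrow> i < m \<Longrightarrow> x $ i = 0"
    and res: "vnorm (?b - ?M *\<^sub>v x) = vnorm (computed_residual N \<mu> d v ?K H y k)"
    using computed_residual_as_full_red_residual[of k y \<mu> \<sigma>] k yk unfolding full by auto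
  show ?thesis
  \<comment> \<open>The case distinction replaces a proof that singular values are nonnegative.\<close>
  proof (cases "sval_min ?M \<ge> 0")
    case True
    have "y m $ k = (y m - x) $ k" using x y k x0[of k] by simp
    then have "cmod (y m $ k) \<le> vnorm (y m - x)"
      using norm_entry_le_vnorm[of k "y m - x"] x k by simp
    then have "sval_min ?M * cmod (y m $ k) \<le> sval_min ?M * vnorm (y m - x)"
      using True by (rule mult_left_mono)
    also have "\<dots> \<le> vnorm (?M *\<^sub>v (y m - x))"
      using M x y by (intro sval_min_mult_vnorm_le) auto
    also have "\<dots> \<le> vnorm (?b - ?M *\<^sub>v x)"
      using M x y minimal by (intro least_squares_projection[of _ "m + 1" _ m]) auto
    finally show ?thesis using res by simp
  next
    case False
    then have "sval_min ?M * cmod (y m $ k) \<le> 0" by (simp add: mult_nonpos_nonneg)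
    then show ?thesis using vnorm_nonneg order_trans by blast
  qed
qed

end

section \<open>The bound on the true residual\<close>

theorem proposition4p2:
  fixes N m :: nat
    and A B H K :: "complex mat"
    and d :: "complex vec"
    and \<mu> :: complex
    and \<sigma> :: "nat \<Rightarrow> complex"
    and t z v y_red :: "nat \<Rightarrow> complex vec"
    and \<epsilon> :: real
  assumes "\<epsilon> > 0"
    and "m \<ge> 1"
    and "inexact_rrk_gmres N m A B d t z v H"
    and "K = K_mat m \<sigma> t H"
    and "\<forall>k\<in>{1..m}. is_red_solution \<mu> d K H k (y_red k)"
    and "\<forall>k\<in>{1..m}. vnorm (computed_residual N \<mu> d v K H y_red (k - 1)) \<noteq> 0"
    and "\<forall>k\<in>{1..m}. vnorm (inner_residual N A B \<sigma> t z v k)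
           \<le> sval_min (K - \<mu> \<cdot>\<^sub>m H) / real m
               * (\<epsilon> / vnorm (computed_residual N \<mu> d v K H y_red (k - 1)))"
  shows "vnorm (true_residual A B \<mu> d (approx_solution N m z y_red))
           \<le> vnorm (computed_residual N \<mu> d v K H y_red m) + \<epsilon>"
proof -
  interpret inexact_rrk_gmres N m A B d t z v H by fact
  let ?r = "computed_residual N \<mu> d v K H y_red"
  let ?p = "inner_residual N A B \<sigma> t z v"
  let ?s = "sval_min (K - \<mu> \<cdot>\<^sub>m H)"
  have y: "y_red k \<in> carrier_vec k" if "k \<in> {1..m}" for k
    using assms(5) that by (auto simp: is_red_solution_def is_arg_min_def)
  have ym: "y_red m \<in> carrier_vec m" using y assms(2) by simp
  have summand: "cmod (y_red m $ j) * vnorm (?p (j + 1)) \<le> \<epsilon> / real m" if j: "j < m" for j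
  proof -
    have "0 < vnorm (?r j)"
      using assms(6)[rule_format, of "j + 1"] j by (simp add: order.not_eq_order_implies_strict)
    have decay: "?s * cmod (y_red m $ j) \<le> vnorm (?r j)"
      unfolding assms(4)
      by (rule solution_entry_decay) (use j y assms(2,4,5) in auto)
    have "cmod (y_red m $ j) * vnorm (?p (j + 1))
        \<le> cmod (y_red m $ j) * (?s / real m * (\<epsilon> / vnorm (?r j)))"
      using assms(7)[rule_format, of "j + 1"] j by (intro mult_left_mono) auto
    also have "\<dots> = ?s * cmod (y_red m $ j) * (\<epsilon> / (real m * vnorm (?r j)))" by simp
    also have "\<dots> \<le> vnorm (?r j) * (\<epsilon> / (real m * vnorm (?r j)))"
      using decay assms(1) by (intro mult_right_mono) auto
    also have "\<dots> = \<epsilon> / real m" using \<open>0 < vnorm (?r j)\<close> by simp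
    finally show ?thesis .
  qed
  have Py: "vnorm (cols_upto N m ?p *\<^sub>v y_red m) \<le> \<epsilon>"
  proof -
    have "vnorm (cols_upto N m ?p *\<^sub>v y_red m)
        \<le> (\<Sum>j<m. cmod (y_red m $ j) * vnorm (col (cols_upto N m ?p) j))"
      by (rule vnorm_mult_mat_vec_le_cols[OF cols_upto_carrier ym])
    also have "\<dots> \<le> (\<Sum>j<m. \<epsilon> / real m)"
      using summand inner_residual_carrier by (intro sum_mono) (simp add: col_cols_upto)
    finally show ?thesis using assms(2) by simp
  qed
  have "vnorm (true_residual A B \<mu> d (approx_solution N m z y_red))
      \<le> vnorm (?r m) + vnorm (cols_upto N m ?p *\<^sub>v y_red m)"
    unfolding true_residual_eq[where y = y_red and \<mu> = \<mu> and \<sigma> = \<sigma>, OF ym assms(2)] assms(4)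
  proof (rule vnorm_triangle[of _ N])
    show "computed_residual N \<mu> d v (K_mat m \<sigma> t H) H y_red m \<in> carrier_vec N"
      using assms(2) by (auto simp: computed_residual_def
          intro!: mult_mat_vec_carrier[OF cols_upto_carrier red_residual_carrier[simplified]])
    show "cols_upto N m ?p *\<^sub>v y_red m \<in> carrier_vec N"
      by (rule mult_mat_vec_carrier[OF cols_upto_carrier ym])
  qed
  then show ?thesis using Py by simp
qed

end
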